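(* For each $n\ge 1$ let $N(n)\in\{1,2,\dots\}\cup\{\infty\}$, and let $X_n=(I_{ni})_{i=1}^{N(n)}$ and $X_n'=(I_{ni}')_{i=1}^{N(n)}$ be (finite or infinite) random vectors, each consisting of independent indicator variables, with $I_{ni}\sim\mathrm{Be}(p_{ni})$ and $I_{ni}'\sim\mathrm{Be}(p_{ni}')$, where $p_{ni},p_{ni}'\in[0,1]$ are deterministic. Write $q_{ni}:=1-p_{ni}$ and $q_{ni}':=1-p_{ni}'$. (i) $X_n\cong X_n'$ (asymptotic equivalence) if and only if $$\sum_{i=1}^{N(n)}\rho(p_{ni},p_{ni}')\to 0\quad\text{as } n\to\infty.$$ (ii) $X_n\vartriangleleft X_n'$ (contiguity of $(X_n)_n$ with respect to $(X_n')_n$) if and only if both $$\sum_{i=1}^{N(n)}\rho(p_{ni},p_{ni}')=O(1)\quad\text{as } n\to\infty$$ and $$\lim_{C\to\infty}\limsup_{n\to\infty}\left(\sum_{i:\,p_{ni}>Cp_{ni}'}p_{ni}+\sum_{i:\,q_{ni}>Cq_{ni}'}q_{ni}\right)=0.$$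
   Context: $\mathrm{Be}(p)$ is the Bernoulli distribution on $\{0,1\}$ with probability $p$ of the value $1$; an indicator variable is a random variable with values in $\{0,1\}$. For $p,q\in[0,1]$, $$\rho(p,q):=\bigl(\sqrt p-\sqrt q\bigr)^2+\bigl(\sqrt{1-p}-\sqrt{1-q}\bigr)^2 .$$ The vectors $X_n,X_n'$ take values in $\{0,1\}^{N(n)}$ with the product $\sigma$-field; if $N(n)=\infty$ the index set is $\{1,2,\dots\}$. Let $X_n$ and $Y_n$ ($n\ge1$) be random variables with values in the same measurable space $(\mathcal X_n,\mathcal A_n)$. The sequence $(X_n)_n$ is asymptotically equivalent to $(Y_n)_n$, written $X_n\cong Y_n$, if $\mathbb P(X_n\in A_n)-\mathbb P(Y_n\in A_n)\to0$ as $n\to\infty$ for every sequence of sets $A_n\in\mathcal A_n$. The sequence $(X_n)_n$ is contiguous with respect to $(Y_n)_n$, written $X_n\vartriangleleft Y_n$, if for every sequence of sets $A_n\in\mathcal A_n$ with $\mathbb P(Y_n\in A_n)\to0$ one also has $\mathbb P(X_n\in A_n)\to0$. These notions depend only on the distributions of $X_n$ and $Y_n$. *)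

theory Defs
  imports "HOL-Probability.Probability"
begin

definition rho :: "real \<Rightarrow> real \<Rightarrow> real" where
  "rho p q = (sqrt p - sqrt q)\<^sup>2 + (sqrt (1 - p) - sqrt (1 - q))\<^sup>2"

definition index_set :: "enat \<Rightarrow> nat set" where
  "index_set N = {i. 1 \<le> i \<and> enat i \<le> N}"

text \<open>
  \<open>{0,1}\<close> is represented by \<^typ>\<open>bool\<close>, the type on which \<^const>\<open>bernoulli_pmf\<close> lives
  (the value 1 is \<^const>\<open>True\<close>).
\<close>
definition cube :: "enat \<Rightarrow> (nat \<Rightarrow> bool) measure" where
  "cube N = Pi\<^sub>M (index_set N) (\<lambda>_. count_space UNIV)"

text \<open>
  In the following two notions the random variables \<open>X n\<close> and \<open>Y n\<close> take values in the same
  measurable space \<open>S n\<close>, but may be defined on different probability spaces \<open>M n\<close> and \<open>M' n\<close>.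
  Sequences are indexed by \<open>n \<ge> 1\<close>.
\<close>
definition asymp_equivalent ::
  "(nat \<Rightarrow> 'c measure) \<Rightarrow> (nat \<Rightarrow> 'a measure) \<Rightarrow> (nat \<Rightarrow> 'a \<Rightarrow> 'c) \<Rightarrow>
   (nat \<Rightarrow> 'b measure) \<Rightarrow> (nat \<Rightarrow> 'b \<Rightarrow> 'c) \<Rightarrow> bool" where
  "asymp_equivalent S M X M' Y \<longleftrightarrow>
     (\<forall>A. (\<forall>n\<ge>1. A n \<in> sets (S n)) \<longrightarrow>
        (\<lambda>n. \<P>(\<omega> in M n. X n \<omega> \<in> A n) - \<P>(\<omega> in M' n. Y n \<omega> \<in> A n)) \<longlonglongrightarrow> 0)"

definition contiguous ::
  "(nat \<Rightarrow> 'c measure) \<Rightarrow> (nat \<Rightarrow> 'a measure) \<Rightarrow> (nat \<Rightarrow> 'a \<Rightarrow> 'c) \<Rightarrow>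
   (nat \<Rightarrow> 'b measure) \<Rightarrow> (nat \<Rightarrow> 'b \<Rightarrow> 'c) \<Rightarrow> bool" where
  "contiguous S M X M' Y \<longleftrightarrow>
     (\<forall>A. (\<forall>n\<ge>1. A n \<in> sets (S n)) \<longrightarrow>
        (\<lambda>n. \<P>(\<omega> in M' n. Y n \<omega> \<in> A n)) \<longlonglongrightarrow> 0 \<longrightarrow>
        (\<lambda>n. \<P>(\<omega> in M n. X n \<omega> \<in> A n)) \<longlonglongrightarrow> 0)"

text \<open>
  \<open>a\<^sub>n = O(1)\<close> as \<open>n \<rightarrow> \<infinity>\<close> for sequences in \<open>[0,\<infinity>]\<close>, where the Landau symbols of the library
  are not available. Finitely many terms may be infinite.
\<close>
definition bounded_at_top :: "(nat \<Rightarrow> ennreal) \<Rightarrow> bool" where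
  "bounded_at_top a \<longleftrightarrow> (\<exists>C::real. \<forall>\<^sub>F n in sequentially. a n \<le> ennreal C)"

end

theory Submission imports Defs begin

text \<open>
  The laws of the two vectors are product measures \<open>P\<close> and \<open>Q\<close>. On finitely many coordinates \<open>J\<close>,
  the Hellinger affinity of the two products is the product of the factors \<open>1 - \<rho>\<^sub>i/2\<close>, hence at least
  \<open>1 - s/2\<close> and at most \<open>exp (- s/2)\<close> for \<open>s = \<Sum>\<^sub>J \<rho>\<^sub>i\<close>. It controls the total variation distance from
  above (Cauchy-Schwarz) and from below (by the set where \<open>P\<close> has the larger weight), which gives (i)
  and the necessity of the first condition in (ii).

  Call a value of a coordinate heavy if its \<open>P\<close>-mass exceeds \<open>C\<close> times its \<open>Q\<close>-mass. The event that
  some coordinate takes a heavy value is hit with \<open>P\<close>-probability at least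
  \<open>1 - exp (- (P-mass of the heavy values))\<close>, while its \<open>Q\<close>-probability is \<open>O(1/C)\<close>; this gives the
  necessity of the second condition. Conversely, off that event the likelihood ratio has a second
  moment bounded by \<open>exp ((1 + sqrt C)\<^sup>2 s)\<close>, so that \<open>P(A)\<close> is bounded by the heavy mass plus a
  multiple of \<open>sqrt (Q(A))\<close>.

  These estimates are uniform in \<open>J\<close> and pass to all measurable sets by approximation with cylinders.
\<close>

section \<open>Finite products\<close>

text \<open>Multiply the bounds \<open>1 - a i \<le> exp (- a i)\<close>; the assumption keeps the
  factors nonnegative, as this requires. For infinite \<open>J\<close> both sides are 1.\<close>

lemma prod_one_minus_le_exp:
  fixes a :: "'i \<Rightarrow> real"
  assumes "\<And>i. i \<in> J \<Longrightarrow> a i \<le> 1"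
  shows "(\<Prod>i\<in>J. 1 - a i) \<le> exp (- (\<Sum>i\<in>J. a i))"
proof (cases "finite J")
  case True
  have "(\<Prod>i\<in>J. 1 - a i) \<le> (\<Prod>i\<in>J. exp (- a i))"
    using assms exp_ge_add_one_self[of "- a i" for i] by (intro prod_mono) auto
  then show ?thesis
    using exp_sum[OF True, of "\<lambda>i. - a i"] by (simp add: sum_negf)
qed simp

section \<open>Hellinger affinity and total variation on finitely many coordinates\<close>

text \<open>Twice the squared Hellinger distance in its usual normalisation; for two Bernoulli laws
  it is \<open>rho\<close>. A general finite value type treats the values 0 and 1 alike, so that the
  terms in \<open>p\<close> and in \<open>1 - p\<close> need no separate arguments.\<close>

definition hellinger :: "'a::finite pmf \<Rightarrow> 'a pmf \<Rightarrow> real" where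
  "hellinger f g = (\<Sum>v\<in>UNIV. (sqrt (pmf f v) - sqrt (pmf g v))\<^sup>2)"

definition weight :: "'i set \<Rightarrow> ('i \<Rightarrow> 'a pmf) \<Rightarrow> ('i \<Rightarrow> 'a) \<Rightarrow> real" where
  "weight J f x = (\<Prod>i\<in>J. pmf (f i) (x i))"

abbreviation points :: "'i set \<Rightarrow> ('i \<Rightarrow> 'a) set" where
  "points J \<equiv> PiE J (\<lambda>_. UNIV)"

lemma weight_nonneg [simp]: "0 \<le> weight J f x"
  by (simp add: weight_def prod_nonneg)

lemma finite_points [simp]: "finite J \<Longrightarrow> finite (points J :: ('i \<Rightarrow> 'a::finite) set)"
  by (intro finite_PiE) auto

lemma sum_pmf_UNIV [simp]: "(\<Sum>v\<in>UNIV. pmf f v) = (1::real)" for f :: "'a::finite pmf"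
  by (rule sum_pmf_eq_1) auto

lemma sum_prod_points:
  fixes u :: "'i \<Rightarrow> 'a::finite \<Rightarrow> real"
  assumes "finite J"
  shows "(\<Sum>x\<in>points J. \<Prod>i\<in>J. u i (x i)) = (\<Prod>i\<in>J. \<Sum>v\<in>UNIV. u i v)"
  by (rule prod_sum_PiE[symmetric]) (use assms in auto)

lemma sum_weight: "finite J \<Longrightarrow> (\<Sum>x\<in>points J. weight J f x) = 1" for f :: "'i \<Rightarrow> 'a::finite pmf"
  unfolding weight_def by (subst sum_prod_points[of J "\<lambda>i. pmf (f i)"]) auto

lemma hellinger_nonneg: "0 \<le> hellinger f g"
  by (simp add: hellinger_def sum_nonneg)

text \<open>Expand the squares: the two total masses contribute 2. The affinity on the left is the
  quantity that multiplies over independent coordinates.\<close>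

lemma affinity_eq: "(\<Sum>v\<in>UNIV. sqrt (pmf f v) * sqrt (pmf g v)) = 1 - hellinger f g / 2"
proof -
  have "hellinger f g = (\<Sum>v\<in>UNIV. pmf f v + pmf g v - 2 * (sqrt (pmf f v) * sqrt (pmf g v)))"
    unfolding hellinger_def by (intro sum.cong) (auto simp: power2_diff)
  then have "hellinger f g = 2 - 2 * (\<Sum>v\<in>UNIV. sqrt (pmf f v) * sqrt (pmf g v))"
    by (simp add: sum.distrib sum_subtractf sum_distrib_left[symmetric])
  then show ?thesis
    by linarith
qed

lemma hellinger_le_2: "hellinger f g \<le> 2"
proof -
  have "0 \<le> (\<Sum>v\<in>UNIV. sqrt (pmf f v) * sqrt (pmf g v))"
    by (intro sum_nonneg) auto
  then show ?thesis
    by (simp add: affinity_eq)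
qed

text \<open>The square root of a product factorises, so the sum over \<open>points J\<close> becomes
  the product of the coordinate affinities.\<close>

lemma affinity_weight:
  fixes f g :: "'i \<Rightarrow> 'a::finite pmf"
  assumes "finite J"
  shows "(\<Sum>x\<in>points J. sqrt (weight J f x) * sqrt (weight J g x)) =
    (\<Prod>i\<in>J. 1 - hellinger (f i) (g i) / 2)"
proof -
  have "sqrt (weight J f x) = (\<Prod>i\<in>J. sqrt (pmf (f i) (x i)))" for f :: "'i \<Rightarrow> 'a pmf" and x
    unfolding weight_def using assms by (induction J rule: finite_induct) (auto simp: real_sqrt_mult)
  then show ?thesis
    using sum_prod_points[OF assms, of "\<lambda>i v. sqrt (pmf (f i) v) * sqrt (pmf (g i) v)"]
    by (simp add: affinity_eq prod.distrib)
qed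

text \<open>Cauchy-Schwarz for the factorisation \<open>(a - b) * (a + b)\<close> of the difference
  of weights, where \<open>a\<close> and \<open>b\<close> are their square roots. With affinity
  \<open>r\<close>, the two factors have squared norms \<open>2 - 2 * r\<close> and
  \<open>2 + 2 * r\<close>.\<close>

lemma sum_weight_diff_le:
  fixes f g :: "'i \<Rightarrow> 'a::finite pmf"
  assumes J: "finite J" and B: "B \<subseteq> points J"
  shows "\<bar>(\<Sum>x\<in>B. weight J f x) - (\<Sum>x\<in>B. weight J g x)\<bar> \<le>
    2 * sqrt (\<Sum>i\<in>J. hellinger (f i) (g i))"
proof -
  define a b where "a x = sqrt (weight J f x)" and "b x = sqrt (weight J g x)" for x
  have sq: "(a x)\<^sup>2 = weight J f x" "(b x)\<^sup>2 = weight J g x" for x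
    by (simp_all add: a_def b_def)
  define h where "h = (\<Sum>i\<in>J. hellinger (f i) (g i))"
  have ab: "(\<Sum>x\<in>points J. a x * b x) = (\<Prod>i\<in>J. 1 - hellinger (f i) (g i) / 2)"
    unfolding a_def b_def by (rule affinity_weight[OF J])
  \<comment> \<open>The Weierstrass product inequality applies because each
    \<open>hellinger (f i) (g i) / 2\<close> lies in [0,1].\<close>
  have "1 - h / 2 \<le> (\<Prod>i\<in>J. 1 - hellinger (f i) (g i) / 2)"
    using Weierstrass_prod_ineq[of J "\<lambda>i. hellinger (f i) (g i) / 2"]
    by (auto simp: h_def hellinger_nonneg hellinger_le_2 sum_divide_distrib)
  then have minus: "(\<Sum>x\<in>points J. (a x - b x)\<^sup>2) \<le> h"
    using ab by (simp add: power2_diff sq sum.distrib sum_subtractf sum_weight J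
        sum_distrib_left[symmetric] mult.assoc)
  have "(\<Prod>i\<in>J. 1 - hellinger (f i) (g i) / 2) \<le> 1"
    by (intro prod_le_1) (auto simp: hellinger_nonneg hellinger_le_2)
  then have plus: "(\<Sum>x\<in>points J. (a x + b x)\<^sup>2) \<le> 4"
    using ab by (simp add: power2_sum sq sum.distrib sum_weight J
        sum_distrib_left[symmetric] mult.assoc)
  have "\<bar>(\<Sum>x\<in>B. weight J f x) - (\<Sum>x\<in>B. weight J g x)\<bar> \<le> (\<Sum>x\<in>B. \<bar>weight J f x - weight J g x\<bar>)"
    by (simp add: sum_subtractf[symmetric])
  also have "\<dots> \<le> (\<Sum>x\<in>points J. \<bar>weight J f x - weight J g x\<bar>)"
    by (intro sum_mono2 J B finite_points) auto
  also have "\<dots> = (\<Sum>x\<in>points J. \<bar>a x - b x\<bar> * \<bar>a x + b x\<bar>)"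
    by (intro sum.cong) (auto simp: sq[symmetric] abs_mult[symmetric] power2_eq_square algebra_simps)
  also have "\<dots> \<le> L2_set (\<lambda>x. a x - b x) (points J) * L2_set (\<lambda>x. a x + b x) (points J)"
    by (rule L2_set_mult_ineq)
  also have "\<dots> \<le> sqrt h * sqrt 4"
    unfolding L2_set_def using minus plus
    by (intro mult_mono real_sqrt_le_mono) (auto intro: sum_nonneg hellinger_nonneg simp: h_def)
  finally show ?thesis
    by (simp add: h_def)
qed

text \<open>\<open>B\<close> is a likelihood ratio test. The sum of its two error probabilities is
  the sum of the minima of the two weights, which is at most the affinity since a minimum is at most
  the geometric mean.\<close>

lemma ex_separating_points:
  fixes f g :: "'i \<Rightarrow> 'a::finite pmf"
  assumes J: "finite J"
  shows "\<exists>B\<subseteq>points J. 1 - exp (- (\<Sum>i\<in>J. hellinger (f i) (g i)) / 2) \<le>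
    (\<Sum>x\<in>B. weight J f x) - (\<Sum>x\<in>B. weight J g x)"
proof -
  define B where "B = {x\<in>points J. weight J g x \<le> weight J f x}"
  have min: "min s t \<le> sqrt s * sqrt t" if "0 \<le> s" "0 \<le> t" for s t :: real
  proof -
    have "min s t = sqrt (min s t) * sqrt (min s t)" using that by simp
    also have "\<dots> \<le> sqrt s * sqrt t" by (intro mult_mono) (use that in auto)
    finally show ?thesis .
  qed
  have "(\<Sum>x\<in>B. weight J g x) + (\<Sum>x\<in>points J - B. weight J f x) =
      (\<Sum>x\<in>B. min (weight J f x) (weight J g x)) + (\<Sum>x\<in>points J - B. min (weight J f x) (weight J g x))"
    by (intro arg_cong2[where f="(+)"] sum.cong) (auto simp: B_def)
  also have "\<dots> = (\<Sum>x\<in>points J. min (weight J f x) (weight J g x))"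
    using sum.subset_diff[of B "points J" "\<lambda>x. min (weight J f x) (weight J g x)"] J
    by (simp add: B_def)
  also have "\<dots> \<le> (\<Sum>x\<in>points J. sqrt (weight J f x) * sqrt (weight J g x))"
    by (intro sum_mono min) auto
  also have "\<dots> \<le> exp (- (\<Sum>i\<in>J. hellinger (f i) (g i)) / 2)"
    using prod_one_minus_le_exp[of J "\<lambda>i. hellinger (f i) (g i) / 2"]
    by (simp add: affinity_weight J hellinger_le_2 sum_divide_distrib)
  finally have "(\<Sum>x\<in>B. weight J g x) + (\<Sum>x\<in>points J - B. weight J f x) \<le>
    exp (- (\<Sum>i\<in>J. hellinger (f i) (g i)) / 2)" .
  moreover have "(\<Sum>x\<in>points J - B. weight J f x) + (\<Sum>x\<in>B. weight J f x) = 1"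
    using sum.subset_diff[of B "points J" "weight J f"] J by (simp add: B_def sum_weight)
  moreover have "B \<subseteq> points J"
    by (auto simp: B_def)
  ultimately show ?thesis
    by (intro exI[of _ B]) auto
qed

section \<open>Heavy values and the truncated second moment of the likelihood ratio\<close>

text \<open>Stated without a quotient, so that a value with zero mass under \<open>g\<close> and
  positive mass under \<open>f\<close> is heavy for every \<open>C\<close>. A light value with zero
  mass under \<open>g\<close> therefore has zero mass under \<open>f\<close>.\<close>

definition heavy :: "real \<Rightarrow> 'a pmf \<Rightarrow> 'a pmf \<Rightarrow> 'a set" where
  "heavy C f g = {v. C * pmf g v < pmf f v}"

text \<open>The points that avoid every \<open>H i\<close> form a box, whose weight is the product
  of one minus the mass of \<open>H i\<close>. The Weierstrass inequality bounds this product from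
  below, the exponential from above.\<close>

lemma sum_weight_exists_le:
  fixes f :: "'i \<Rightarrow> 'a::finite pmf"
  assumes J: "finite J"
  shows "(\<Sum>x\<in>{x\<in>points J. \<exists>i\<in>J. x i \<in> H i}. weight J f x) \<le> (\<Sum>i\<in>J. \<Sum>v\<in>H i. pmf (f i) v)"
    and "1 - exp (- (\<Sum>i\<in>J. \<Sum>v\<in>H i. pmf (f i) v)) \<le>
      (\<Sum>x\<in>{x\<in>points J. \<exists>i\<in>J. x i \<in> H i}. weight J f x)"
proof -
  let ?E = "{x\<in>points J. \<exists>i\<in>J. x i \<in> H i}"
  have compl: "(\<Sum>v\<in>-H i. pmf (f i) v) = 1 - (\<Sum>v\<in>H i. pmf (f i) v)" for i
    using sum.subset_diff[of "H i" UNIV "pmf (f i)"] by (simp add: Compl_eq_Diff_UNIV)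
  have le1: "(\<Sum>v\<in>H i. pmf (f i) v) \<le> 1" for i
    using sum_mono2[of UNIV "H i" "pmf (f i)"] by simp
  have "(\<Sum>x\<in>points J - ?E. weight J f x) = (\<Sum>x\<in>PiE J (\<lambda>i. - H i). weight J f x)"
    by (intro sum.cong) (auto simp: PiE_def Pi_def)
  also have "\<dots> = (\<Prod>i\<in>J. 1 - (\<Sum>v\<in>H i. pmf (f i) v))"
    unfolding weight_def by (subst prod_sum_PiE[symmetric]) (use J compl in auto)
  finally have eq: "(\<Sum>x\<in>?E. weight J f x) = 1 - (\<Prod>i\<in>J. 1 - (\<Sum>v\<in>H i. pmf (f i) v))"
    using sum.subset_diff[of ?E "points J" "weight J f"] J by (simp add: sum_weight)
  show "(\<Sum>x\<in>?E. weight J f x) \<le> (\<Sum>i\<in>J. \<Sum>v\<in>H i. pmf (f i) v)"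
    using Weierstrass_prod_ineq[of J "\<lambda>i. \<Sum>v\<in>H i. pmf (f i) v"] le1 eq
    by (simp add: sum_nonneg)
  show "1 - exp (- (\<Sum>i\<in>J. \<Sum>v\<in>H i. pmf (f i) v)) \<le> (\<Sum>x\<in>?E. weight J f x)"
    using prod_one_minus_le_exp[of J "\<lambda>i. \<Sum>v\<in>H i. pmf (f i) v"] le1 eq by simp
qed

text \<open>
  The linear part of \<open>f\<^sup>2/g = g + 2(f - g) + (f - g)\<^sup>2/g\<close> sums to at most 1 over the values outside
  \<open>heavy C f g\<close>, since the heavy values have at least as much mass under \<open>f\<close> as under \<open>g\<close>.
\<close>
lemma sum_light_square_le:
  fixes f g :: "'a::finite pmf"
  assumes C: "1 \<le> C"
  shows "(\<Sum>v\<in>- heavy C f g. (pmf f v)\<^sup>2 / pmf g v) \<le> 1 + (1 + sqrt C)\<^sup>2 * hellinger f g"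
proof -
  let ?H = "heavy C f g"
  have pt: "(pmf f v)\<^sup>2 / pmf g v \<le>
      (2 * pmf f v - pmf g v) + (1 + sqrt C)\<^sup>2 * (sqrt (pmf f v) - sqrt (pmf g v))\<^sup>2"
    if v: "v \<in> - ?H" for v
  proof (cases "pmf g v = 0")
    case False
    define a b where "a = sqrt (pmf f v)" and "b = sqrt (pmf g v)"
    have b: "b > 0" using False by (simp add: b_def pmf_pos)
    have a: "a \<ge> 0" by (simp add: a_def)
    have sq: "pmf f v = a\<^sup>2" "pmf g v = b\<^sup>2" by (simp_all add: a_def b_def)
    have "pmf f v \<le> C * pmf g v"
      using v by (simp add: heavy_def)
    then have "a \<le> sqrt C * b"
      unfolding a_def b_def real_sqrt_mult[symmetric] by (rule real_sqrt_le_mono)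
    then have "a + b \<le> (1 + sqrt C) * b"
      by (simp add: algebra_simps)
    then have "(a + b)\<^sup>2 \<le> ((1 + sqrt C) * b)\<^sup>2"
      using a b by (intro power_mono) auto
    then have "(a + b)\<^sup>2 / b\<^sup>2 \<le> (1 + sqrt C)\<^sup>2"
      using b by (simp add: power_mult_distrib divide_le_eq)
    then have "(a + b)\<^sup>2 / b\<^sup>2 * (a - b)\<^sup>2 \<le> (1 + sqrt C)\<^sup>2 * (a - b)\<^sup>2"
      by (intro mult_right_mono) auto
    moreover have "(a\<^sup>2)\<^sup>2 / b\<^sup>2 = (2 * a\<^sup>2 - b\<^sup>2) + (a + b)\<^sup>2 / b\<^sup>2 * (a - b)\<^sup>2"
      using b by (simp add: field_simps power2_eq_square)
    ultimately show ?thesis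
      unfolding sq using a b by simp
  \<comment> \<open>In the remaining case \<open>pmf g v = 0\<close>, lightness forces
    \<open>pmf f v = 0\<close>, and the left side is 0 because division by zero gives 0.\<close>
  qed (use v in \<open>auto simp: heavy_def not_less\<close>)
  have split: "(\<Sum>v\<in>- ?H. pmf h v) = 1 - (\<Sum>v\<in>?H. pmf h v)" for h
    using sum.subset_diff[of ?H UNIV "pmf h"] by (simp add: Compl_eq_Diff_UNIV)
  have "(\<Sum>v\<in>?H. pmf g v) \<le> (\<Sum>v\<in>?H. pmf f v)"
  proof (rule sum_mono)
    fix v assume "v \<in> ?H"
    then show "pmf g v \<le> pmf f v"
      using mult_right_mono[OF C, of "pmf g v"] by (simp add: heavy_def)
  qed
  moreover have "0 \<le> (\<Sum>v\<in>?H. pmf f v)"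
    by (simp add: sum_nonneg)
  ultimately have lin: "(\<Sum>v\<in>- ?H. 2 * pmf f v - pmf g v) \<le> 1"
    by (simp add: sum_subtractf sum_distrib_left[symmetric] split)
  have "(\<Sum>v\<in>- ?H. (sqrt (pmf f v) - sqrt (pmf g v))\<^sup>2) \<le> hellinger f g"
    unfolding hellinger_def by (intro sum_mono2) auto
  then have "(1 + sqrt C)\<^sup>2 * (\<Sum>v\<in>- ?H. (sqrt (pmf f v) - sqrt (pmf g v))\<^sup>2) \<le> (1 + sqrt C)\<^sup>2 * hellinger f g"
    by (intro mult_left_mono) auto
  moreover have "(\<Sum>v\<in>- ?H. (pmf f v)\<^sup>2 / pmf g v) \<le> (\<Sum>v\<in>- ?H. 2 * pmf f v - pmf g v) +
      (1 + sqrt C)\<^sup>2 * (\<Sum>v\<in>- ?H. (sqrt (pmf f v) - sqrt (pmf g v))\<^sup>2)"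
    unfolding sum_distrib_left sum.distrib[symmetric] by (intro sum_mono pt)
  ultimately show ?thesis
    using lin by linarith
qed

text \<open>Split \<open>B\<close> along the event \<open>E\<close> that some coordinate is heavy.
  The part in \<open>E\<close> costs at most the heavy mass by the union bound; on the rest apply
  Cauchy-Schwarz to \<open>weight J f x / sqrt (weight J g x)\<close> and
  \<open>sqrt (weight J g x)\<close>.\<close>

lemma sum_weight_le:
  fixes f g :: "'i \<Rightarrow> 'a::finite pmf"
  assumes J: "finite J" and B: "B \<subseteq> points J" and C: "1 \<le> C"
  shows "(\<Sum>x\<in>B. weight J f x) \<le> (\<Sum>i\<in>J. \<Sum>v\<in>heavy C (f i) (g i). pmf (f i) v) +
    sqrt (exp ((1 + sqrt C)\<^sup>2 * (\<Sum>i\<in>J. hellinger (f i) (g i))) * (\<Sum>x\<in>B. weight J g x))"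
proof -
  let ?H = "\<lambda>i. heavy C (f i) (g i)"
  define E where "E = {x\<in>points J. \<exists>i\<in>J. x i \<in> ?H i}"
  let ?L = "PiE J (\<lambda>i. - ?H i)"
  have fB: "finite B" using B J finite_subset finite_points by blast
  have BL: "B - E \<subseteq> ?L"
    using B by (auto simp: E_def PiE_def Pi_def)
  \<comment> \<open>This makes the later cancellation of \<open>sqrt (weight J g x)\<close> valid
    also at points where it vanishes.\<close>
  have light: "weight J f x = 0" if x: "x \<in> ?L" and zero: "weight J g x = 0" for x
  proof -
    obtain i where i: "i \<in> J" "pmf (g i) (x i) = 0"
      using zero J by (auto simp: weight_def)
    then have "x i \<notin> ?H i" using x by auto
    then have "pmf (f i) (x i) = 0"
      using i(2) pmf_nonneg[of "f i" "x i"] by (simp add: heavy_def del: pmf_nonneg)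
    then show ?thesis
      using i J by (auto simp: weight_def)
  qed
  \<comment> \<open>On the box \<open>?L\<close> the second moment of the likelihood ratio
    factorises over the coordinates.\<close>
  have "(\<Sum>x\<in>?L. (weight J f x / sqrt (weight J g x))\<^sup>2) =
      (\<Sum>x\<in>?L. \<Prod>i\<in>J. (pmf (f i) (x i))\<^sup>2 / pmf (g i) (x i))"
    by (intro sum.cong) (auto simp: power_divide weight_def prod_dividef prod_power_distrib prod_nonneg)
  also have "\<dots> = (\<Prod>i\<in>J. \<Sum>v\<in>- ?H i. (pmf (f i) v)\<^sup>2 / pmf (g i) v)"
    by (rule prod_sum_PiE[symmetric]) (use J in auto)
  also have "\<dots> \<le> (\<Prod>i\<in>J. exp ((1 + sqrt C)\<^sup>2 * hellinger (f i) (g i)))"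
  proof (intro prod_mono conjI sum_nonneg)
    fix i
    show "(\<Sum>v\<in>- ?H i. (pmf (f i) v)\<^sup>2 / pmf (g i) v) \<le> exp ((1 + sqrt C)\<^sup>2 * hellinger (f i) (g i))"
      using sum_light_square_le[OF C, of "f i" "g i"] exp_ge_add_one_self order_trans by blast
  qed auto
  also have "\<dots> = exp ((1 + sqrt C)\<^sup>2 * (\<Sum>i\<in>J. hellinger (f i) (g i)))"
    using J by (simp add: exp_sum sum_distrib_left)
  finally have sq: "(\<Sum>x\<in>?L. (weight J f x / sqrt (weight J g x))\<^sup>2) \<le>
    exp ((1 + sqrt C)\<^sup>2 * (\<Sum>i\<in>J. hellinger (f i) (g i)))" .
  have "(\<Sum>x\<in>B - E. weight J f x) =
      (\<Sum>x\<in>B - E. \<bar>weight J f x / sqrt (weight J g x)\<bar> * \<bar>sqrt (weight J g x)\<bar>)"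
    by (rule sum.cong) (use light BL in auto)
  also have "\<dots> \<le> L2_set (\<lambda>x. weight J f x / sqrt (weight J g x)) (B - E) *
      L2_set (\<lambda>x. sqrt (weight J g x)) (B - E)"
    by (rule L2_set_mult_ineq)
  also have "\<dots> = sqrt ((\<Sum>x\<in>B - E. (weight J f x / sqrt (weight J g x))\<^sup>2) * (\<Sum>x\<in>B - E. weight J g x))"
    by (simp add: L2_set_def real_sqrt_mult)
  also have "\<dots> \<le> sqrt (exp ((1 + sqrt C)\<^sup>2 * (\<Sum>i\<in>J. hellinger (f i) (g i))) * (\<Sum>x\<in>B. weight J g x))"
  proof (intro real_sqrt_le_mono mult_mono)
    have "(\<Sum>x\<in>B - E. (weight J f x / sqrt (weight J g x))\<^sup>2) \<le>
        (\<Sum>x\<in>?L. (weight J f x / sqrt (weight J g x))\<^sup>2)"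
      by (intro sum_mono2 BL) (use J in \<open>auto intro!: finite_PiE\<close>)
    with sq show "(\<Sum>x\<in>B - E. (weight J f x / sqrt (weight J g x))\<^sup>2) \<le>
        exp ((1 + sqrt C)\<^sup>2 * (\<Sum>i\<in>J. hellinger (f i) (g i)))"
      by linarith
    show "(\<Sum>x\<in>B - E. weight J g x) \<le> (\<Sum>x\<in>B. weight J g x)"
      by (intro sum_mono2 fB) auto
  qed (auto intro: sum_nonneg)
  finally have 1: "(\<Sum>x\<in>B - E. weight J f x) \<le>
    sqrt (exp ((1 + sqrt C)\<^sup>2 * (\<Sum>i\<in>J. hellinger (f i) (g i))) * (\<Sum>x\<in>B. weight J g x))" .
  have "(\<Sum>x\<in>B \<inter> E. weight J f x) \<le> (\<Sum>x\<in>E. weight J f x)"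
    by (intro sum_mono2) (use J in \<open>auto simp: E_def\<close>)
  also have "\<dots> \<le> (\<Sum>i\<in>J. \<Sum>v\<in>?H i. pmf (f i) v)"
    unfolding E_def by (rule sum_weight_exists_le(1)[OF J])
  finally show ?thesis
    using 1 sum.Int_Diff[OF fB, of "weight J f" E] by simp
qed

section \<open>Infinite products\<close>

text \<open>Induction over \<open>sigma_sets\<close>, with one \<open>B\<close> for both measures at
  once. Complements leave the symmetric difference unchanged. A countable union is cut off at an
  index \<open>m\<close> where the missing part is small under both measures, and its first
  \<open>m\<close> members are approximated.\<close>

lemma sigma_sets_approximation:
  assumes G: "algebra \<Omega> G"
    and P: "finite_measure P" "sets P = sigma_sets \<Omega> G"
    and Q: "finite_measure Q" "sets Q = sigma_sets \<Omega> G"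
    and A: "A \<in> sigma_sets \<Omega> G" and e: "0 < e"
  shows "\<exists>B\<in>G. measure P (sym_diff A B) < e \<and> measure Q (sym_diff A B) < e"
  using A e
proof (induction A arbitrary: e rule: sigma_sets.induct)
  case (Basic a)
  then show ?case by (intro bexI[of _ a]) auto
next
  case Empty
  interpret algebra \<Omega> G by fact
  show ?case using Empty by (intro bexI[of _ "{}"]) auto
next
  case (Compl a)
  interpret algebra \<Omega> G by fact
  obtain B where B: "B \<in> G" "measure P (sym_diff a B) < e" "measure Q (sym_diff a B) < e"
    using Compl.IH[OF Compl.prems] by blast
  have "a \<subseteq> \<Omega>" "B \<subseteq> \<Omega>"
    using sigma_sets_into_sp[OF space_closed Compl.hyps] sets_into_space[OF B(1)] by auto
  then have "sym_diff (\<Omega> - a) (\<Omega> - B) = sym_diff a B"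
    by auto
  then show ?case
    using B by (intro bexI[of _ "\<Omega> - B"]) auto
next
  case (Union a)
  interpret algebra \<Omega> G by fact
  \<comment> \<open>\<open>T m\<close> is the part of the union missed by the first \<open>m\<close>
    sets; it decreases to the empty set.\<close>
  define T where "T m = (\<Union>i. a i) - (\<Union>i<m. a i)" for m :: nat
  have T_sets: "T m \<in> sigma_sets \<Omega> G" for m
  proof -
    have "a i \<in> sets P" for i
      using Union.hyps by (simp add: P(2))
    then have "T m \<in> sets P"
      unfolding T_def by (intro sets.Diff sets.countable_UN sets.finite_UN) auto
    then show ?thesis
      by (simp add: P(2))
  qed
  have tail: "(\<lambda>m. measure R (T m)) \<longlonglongrightarrow> 0" if "finite_measure R" "sets R = sigma_sets \<Omega> G" for R
  proof -
    interpret finite_measure R by fact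
    have "(\<lambda>m. measure R (T m)) \<longlonglongrightarrow> measure R (\<Inter>m. T m)"
      by (rule finite_Lim_measure_decseq)
        (use T_sets that in \<open>auto simp: decseq_def T_def\<close>)
    moreover have "(\<Inter>m. T m) = {}"
      by (auto simp: T_def)
    ultimately show ?thesis by simp
  qed
  have "\<forall>\<^sub>F m in sequentially. measure P (T m) < e / 2 \<and> measure Q (T m) < e / 2"
    using order_tendstoD(2)[OF tail[OF P], of "e / 2"] order_tendstoD(2)[OF tail[OF Q], of "e / 2"]
      \<open>0 < e\<close> by (intro eventually_conj) auto
  then obtain m where m: "measure P (T m) < e / 2" "measure Q (T m) < e / 2"
    by (auto simp: eventually_sequentially)
  \<comment> \<open>The \<open>m\<close> approximation errors then add up to at most
    \<open>e / 2\<close>; the \<open>+ 1\<close> keeps the denominator positive for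
    \<open>m = 0\<close>.\<close>
  define d where "d = e / (2 * (real m + 1))"
  have "0 < d" using \<open>0 < e\<close> by (simp add: d_def)
  then have "\<exists>B\<in>G. measure P (sym_diff (a i) B) < d \<and> measure Q (sym_diff (a i) B) < d" for i
    by (rule Union.IH)
  then obtain B where B: "\<And>i. B i \<in> G" "\<And>i. measure P (sym_diff (a i) (B i)) < d"
      "\<And>i. measure Q (sym_diff (a i) (B i)) < d"
    by metis
  have close: "measure R (sym_diff (\<Union>i. a i) (\<Union>i<m. B i)) < e"
    if "finite_measure R" and R: "sets R = sigma_sets \<Omega> G" and Tm: "measure R (T m) < e / 2"
      and d: "\<And>i. measure R (sym_diff (a i) (B i)) < d" for R
  proof -
    interpret finite_measure R by fact
    have s: "a i \<in> sets R" "B i \<in> sets R" "T m \<in> sets R" for i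
      using Union.hyps B(1) T_sets by (auto simp: R)
    have "measure R (sym_diff (\<Union>i. a i) (\<Union>i<m. B i)) \<le> measure R (T m \<union> (\<Union>i<m. sym_diff (a i) (B i)))"
    proof (rule finite_measure_mono)
      show "sym_diff (\<Union>i. a i) (\<Union>i<m. B i) \<subseteq> T m \<union> (\<Union>i<m. sym_diff (a i) (B i))"
        unfolding T_def by blast
    qed (use s in auto)
    also have "\<dots> \<le> measure R (T m) + measure R (\<Union>i<m. sym_diff (a i) (B i))"
      by (rule measure_subadditive) (use s in auto)
    also have "measure R (\<Union>i<m. sym_diff (a i) (B i)) \<le> (\<Sum>i<m. measure R (sym_diff (a i) (B i)))"
      by (rule finite_measure_subadditive_finite) (use s in auto)
    also have "\<dots> \<le> (\<Sum>i<m. d)"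
      by (intro sum_mono less_imp_le d)
    also have "\<dots> \<le> e / 2"
      using \<open>0 < e\<close> by (simp add: d_def field_simps)
    finally show ?thesis using Tm by simp
  qed
  show ?case
    using close[OF P m(1) B(2)] close[OF Q m(2) B(3)] B(1)
    by (intro bexI[of _ "\<Union>i<m. B i"]) auto
qed

section \<open>Cylinders of product measures and transfer of the finite bounds\<close>

abbreviation product :: "'i set \<Rightarrow> ('i \<Rightarrow> 'a pmf) \<Rightarrow> ('i \<Rightarrow> 'a) measure" where
  "product I f \<equiv> PiM I (\<lambda>i. measure_pmf (f i))"

abbreviation cylinder :: "'i set \<Rightarrow> 'i set \<Rightarrow> ('i \<Rightarrow> 'a) set \<Rightarrow> ('i \<Rightarrow> 'a) set" where
  "cylinder I \<equiv> prod_emb I (\<lambda>_. count_space UNIV)"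

lemma product_prob_space_pmf: "product_prob_space (\<lambda>i. measure_pmf (f i))"
  by (intro product_prob_spaceI measure_pmf.prob_space_axioms)

lemma prob_space_product: "prob_space (product I f)"
  by (intro prob_space_PiM measure_pmf.prob_space_axioms)

lemma sets_product: "sets (product I f) = sets (PiM I (\<lambda>_. count_space UNIV))"
  by (intro sets_PiM_cong) auto

lemma sets_PiM_count_space_finite:
  "finite J \<Longrightarrow> sets (PiM J (\<lambda>_. count_space (UNIV :: 'a::finite set))) = Pow (points J)"
  by (subst count_space_PiM_finite) (auto simp: uncountable_infinite)

lemma cylinder_in_sets:
  fixes f :: "'i \<Rightarrow> 'a::finite pmf"
  assumes "finite J" "J \<subseteq> I" "B \<subseteq> points J"
  shows "cylinder I J B \<in> sets (product I f)"
  unfolding sets_product using assms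
  by (intro measurable_prod_emb) (auto simp: sets_PiM_count_space_finite)

text \<open>A singleton \<open>{x}\<close> is a box, so the measure of its cylinder is a product;
  \<open>B\<close> is a finite disjoint union of singletons.\<close>

lemma measure_cylinder:
  fixes f :: "'i \<Rightarrow> 'a::finite pmf"
  assumes J: "finite J" "J \<subseteq> I" and B: "B \<subseteq> points J"
  shows "measure (product I f) (cylinder I J B) = (\<Sum>x\<in>B. weight J f x)"
proof -
  interpret product_prob_space "\<lambda>i. measure_pmf (f i)" I
    by (rule product_prob_space_pmf)
  \<comment> \<open>The embedding depends on the factors only through their spaces, which are
    \<open>UNIV\<close> for \<open>count_space\<close> and \<open>measure_pmf\<close> alike.\<close>
  have emb: "cylinder I J B = emb I J B" for B
    by (simp add: prod_emb_def)
  have single: "measure (product I f) (cylinder I J {x}) = weight J f x" if "x \<in> points J" for x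
  proof -
    have "{x} = PiE J (\<lambda>i. {x i})"
      using PiE_singleton[of x J] that by (simp add: PiE_def)
    then show ?thesis
      using measure_PiM_emb[OF J(2,1), of "\<lambda>i. {x i}"]
      by (simp add: emb weight_def measure_pmf_single)
  qed
  have fB: "finite B"
    using B J finite_subset finite_points by blast
  have "cylinder I J B = (\<Union>x\<in>B. cylinder I J {x})"
    by (auto simp: prod_emb_def)
  also have "measure (product I f) \<dots> = (\<Sum>x\<in>B. measure (product I f) (cylinder I J {x}))"
  proof (rule finite_measure_finite_Union[OF fB])
    show "(\<lambda>x. cylinder I J {x}) ` B \<subseteq> events"
      using cylinder_in_sets[OF J, of "{x}" f for x] B by auto
  qed (auto simp: disjoint_family_on_def prod_emb_def)
  also have "\<dots> = (\<Sum>x\<in>B. weight J f x)"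
    using B by (intro sum.cong single) auto
  finally show ?thesis .
qed

text \<open>Cylinders over finite index sets form the generating algebra, and the measures of two
  sets differ by at most the measure of their symmetric difference. The same \<open>J\<close> and
  \<open>B\<close> serve both products, so that finite comparisons carry over.\<close>

lemma product_approximation:
  fixes f g :: "'i \<Rightarrow> 'a::finite pmf"
  assumes A: "A \<in> sets (PiM I (\<lambda>_. count_space UNIV))" and e: "0 < e"
  obtains J B where "finite J" "J \<subseteq> I" "B \<subseteq> points J"
    "\<bar>measure (product I f) A - (\<Sum>x\<in>B. weight J f x)\<bar> < e"
    "\<bar>measure (product I g) A - (\<Sum>x\<in>B. weight J g x)\<bar> < e"
proof -
  interpret P: product_prob_space "\<lambda>i. measure_pmf (f i)" I
    by (rule product_prob_space_pmf)
  interpret Q: prob_space "product I g"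
    by (rule prob_space_product)
  have sets: "sets (product I f) = sigma_sets (space (product I f)) P.generator"
    by (rule P.sets_PiM_generator)
  have "\<exists>B\<in>P.generator. measure (product I f) (sym_diff A B) < e \<and> measure (product I g) (sym_diff A B) < e"
    by (rule sigma_sets_approximation[OF P.algebra_generator])
      (use sets A e in \<open>auto simp: sets_product P.finite_measure_axioms Q.finite_measure_axioms\<close>)
  then obtain D where D: "D \<in> P.generator" "measure (product I f) (sym_diff A D) < e"
      "measure (product I g) (sym_diff A D) < e"
    by blast
  from D(1) obtain J B where J: "finite J" "J \<subseteq> I" and B: "B \<subseteq> points J" and D_eq: "D = cylinder I J B"
    by (auto elim!: P.generator.cases simp: sets_product sets_PiM_count_space_finite prod_emb_def)
  have diff: "\<bar>measure R A - measure R D\<bar> \<le> measure R (sym_diff A D)"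
    if "prob_space R" "sets R = sets (PiM I (\<lambda>_. count_space UNIV))" for R
  proof -
    interpret prob_space R by fact
    have s: "A \<in> sets R" "D \<in> sets R"
      using A cylinder_in_sets[OF J B, of f] by (auto simp: that(2) D_eq sets_product)
    have "measure R A \<le> measure R (D \<union> sym_diff A D)" "measure R D \<le> measure R (A \<union> sym_diff A D)"
      using s by (auto intro!: finite_measure_mono)
    moreover have "measure R (D \<union> sym_diff A D) \<le> measure R D + measure R (sym_diff A D)"
        "measure R (A \<union> sym_diff A D) \<le> measure R A + measure R (sym_diff A D)"
      using s by (auto intro!: measure_subadditive)
    ultimately show ?thesis by linarith
  qed
  show ?thesis
    by (rule that[OF J B])
      (use D diff[OF prob_space_product sets_product, of f] diff[OF prob_space_product sets_product, of g]
        in \<open>auto simp: D_eq measure_cylinder J B\<close>)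
qed

text \<open>\<open>c\<close> bounds all finite partial sums, so the finite estimate holds with the
  same \<open>c\<close> for every approximating \<open>J\<close>; the two approximation errors add
  up to \<open>e\<close>.\<close>

lemma product_measure_diff_le:
  fixes f g :: "'i \<Rightarrow> 'a::finite pmf"
  assumes A: "A \<in> sets (PiM I (\<lambda>_. count_space UNIV))"
    and c: "\<And>J. finite J \<Longrightarrow> J \<subseteq> I \<Longrightarrow> (\<Sum>i\<in>J. hellinger (f i) (g i)) \<le> c"
  shows "\<bar>measure (product I f) A - measure (product I g) A\<bar> \<le> 2 * sqrt c"
proof (rule field_le_epsilon)
  fix e :: real assume "0 < e"
  then have "0 < e / 2" by simp
  from product_approximation[OF A this, of f g] obtain J B where J: "finite J" "J \<subseteq> I" "B \<subseteq> points J"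
    and "\<bar>measure (product I f) A - (\<Sum>x\<in>B. weight J f x)\<bar> < e / 2"
    and "\<bar>measure (product I g) A - (\<Sum>x\<in>B. weight J g x)\<bar> < e / 2"
    by blast
  moreover have "2 * sqrt (\<Sum>i\<in>J. hellinger (f i) (g i)) \<le> 2 * sqrt c"
    using c[OF J(1,2)] by simp
  ultimately show "\<bar>measure (product I f) A - measure (product I g) A\<bar> \<le> 2 * sqrt c + e"
    using sum_weight_diff_le[OF J(1,3), of f g] by linarith
qed

lemma product_measure_le:
  fixes f g :: "'i \<Rightarrow> 'a::finite pmf"
  assumes A: "A \<in> sets (PiM I (\<lambda>_. count_space UNIV))" and C: "1 \<le> C"
    and s: "\<And>J. finite J \<Longrightarrow> J \<subseteq> I \<Longrightarrow> (\<Sum>i\<in>J. hellinger (f i) (g i)) \<le> s"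
    and d: "\<And>J. finite J \<Longrightarrow> J \<subseteq> I \<Longrightarrow> (\<Sum>i\<in>J. \<Sum>v\<in>heavy C (f i) (g i). pmf (f i) v) \<le> d"
  shows "measure (product I f) A \<le> d + sqrt (exp ((1 + sqrt C)\<^sup>2 * s) * measure (product I g) A)"
proof -
  let ?K = "exp ((1 + sqrt C)\<^sup>2 * s)"
  have approx: "measure (product I f) A \<le> d + sqrt (?K * (measure (product I g) A + e)) + e" if "0 < e" for e
  proof -
    from product_approximation[OF A that, of f g] obtain J B
      where J: "finite J" "J \<subseteq> I" "B \<subseteq> points J"
        and f: "\<bar>measure (product I f) A - (\<Sum>x\<in>B. weight J f x)\<bar> < e"
        and g: "\<bar>measure (product I g) A - (\<Sum>x\<in>B. weight J g x)\<bar> < e"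
      by blast
    have "exp ((1 + sqrt C)\<^sup>2 * (\<Sum>i\<in>J. hellinger (f i) (g i))) * (\<Sum>x\<in>B. weight J g x) \<le>
        ?K * (measure (product I g) A + e)"
      using s[OF J(1,2)] g by (intro mult_mono) (auto intro!: mult_left_mono sum_nonneg)
    then have "sqrt (exp ((1 + sqrt C)\<^sup>2 * (\<Sum>i\<in>J. hellinger (f i) (g i))) * (\<Sum>x\<in>B. weight J g x)) \<le>
        sqrt (?K * (measure (product I g) A + e))"
      by (rule real_sqrt_le_mono)
    then show ?thesis
      using sum_weight_le[OF J(1,3) C, of f g] d[OF J(1,2)] f by linarith
  qed
  \<comment> \<open>The approximation error also enters under the square root, so it is removed by
    letting \<open>e\<close> tend to 0 from above.\<close>
  have "((\<lambda>e. d + sqrt (?K * (measure (product I g) A + e)) + e) \<longlongrightarrow>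
      d + sqrt (?K * (measure (product I g) A + 0)) + 0) (at_right 0)"
    by (intro tendsto_intros)
  then have "measure (product I f) A \<le> d + sqrt (?K * (measure (product I g) A + 0)) + 0"
    by (rule tendsto_lowerbound)
      (use approx in \<open>auto simp: eventually_at_right_field intro!: exI[of _ 1]\<close>)
  then show ?thesis by simp
qed

lemma ex_separating_set:
  fixes f g :: "'i \<Rightarrow> 'a::finite pmf"
  assumes "finite J" "J \<subseteq> I"
  shows "\<exists>A\<in>sets (PiM I (\<lambda>_. count_space UNIV)). 1 - exp (- (\<Sum>i\<in>J. hellinger (f i) (g i)) / 2) \<le>
    measure (product I f) A - measure (product I g) A"
proof -
  obtain B where B: "B \<subseteq> points J" "1 - exp (- (\<Sum>i\<in>J. hellinger (f i) (g i)) / 2) \<le>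
      (\<Sum>x\<in>B. weight J f x) - (\<Sum>x\<in>B. weight J g x)"
    using ex_separating_points[OF assms(1), of f g] by blast
  then show ?thesis
    using measure_cylinder[OF assms B(1), of f] measure_cylinder[OF assms B(1), of g]
      cylinder_in_sets[OF assms B(1), of f]
    by (intro bexI[of _ "cylinder I J B"]) (auto simp: sets_product)
qed

text \<open>The event is that some coordinate in \<open>J\<close> falls in its \<open>H i\<close>.
  For heavy values and \<open>C > 0\<close> the bound under \<open>g\<close> is at most
  \<open>1 / C\<close> times the heavy mass under \<open>f\<close>, a contrast to be confronted with
  contiguity.\<close>

lemma ex_hitting_set:
  fixes f g :: "'i \<Rightarrow> 'a::finite pmf"
  assumes "finite J" "J \<subseteq> I"
  shows "\<exists>A\<in>sets (PiM I (\<lambda>_. count_space UNIV)).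
    1 - exp (- (\<Sum>i\<in>J. \<Sum>v\<in>H i. pmf (f i) v)) \<le> measure (product I f) A \<and>
    measure (product I g) A \<le> (\<Sum>i\<in>J. \<Sum>v\<in>H i. pmf (g i) v)"
proof -
  let ?B = "{x\<in>points J. \<exists>i\<in>J. x i \<in> H i}"
  have B: "?B \<subseteq> points J" by auto
  show ?thesis
    using measure_cylinder[OF assms B, of f] measure_cylinder[OF assms B, of g]
      cylinder_in_sets[OF assms B, of f] sum_weight_exists_le[OF assms(1), where H = H]
    by (intro bexI[of _ "cylinder I J ?B"]) (auto simp: sets_product)
qed

section \<open>Asymptotic equivalence and contiguity\<close>

text \<open>Choosing in each \<open>S n\<close> a set that violates the bound, if there is one,
  turns a statement about all sequences of sets into one that is uniform over sets.\<close>

lemma asymp_equivalent_iff: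
  "asymp_equivalent S M X M' Y \<longleftrightarrow>
    (\<forall>e>0. \<forall>\<^sub>F n in sequentially. \<forall>A\<in>sets (S n).
      \<bar>\<P>(\<omega> in M n. X n \<omega> \<in> A) - \<P>(\<omega> in M' n. Y n \<omega> \<in> A)\<bar> \<le> e)"
  (is "_ \<longleftrightarrow> (\<forall>e>0. \<forall>\<^sub>F n in sequentially. \<forall>A\<in>sets (S n). \<bar>?D n A\<bar> \<le> e)")
proof (intro iffI allI impI)
  fix e :: real assume eq: "asymp_equivalent S M X M' Y" and e: "0 < e"
  \<comment> \<open>The default \<open>{}\<close> lies in every \<open>S n\<close>, so the chosen
    sequence is admissible.\<close>
  define A where "A n = (if \<exists>A\<in>sets (S n). \<not> \<bar>?D n A\<bar> \<le> e
    then SOME A. A \<in> sets (S n) \<and> \<not> \<bar>?D n A\<bar> \<le> e else {})" for n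
  have A: "A n \<in> sets (S n) \<and> \<not> \<bar>?D n (A n)\<bar> \<le> e" if "\<exists>A\<in>sets (S n). \<not> \<bar>?D n A\<bar> \<le> e" for n
    unfolding A_def if_P[OF that] by (rule someI_ex) (use that in blast)
  have "A n \<in> sets (S n)" for n
    using A[of n] by (cases "\<exists>A\<in>sets (S n). \<not> \<bar>?D n A\<bar> \<le> e") (auto simp: A_def)
  then have "(\<lambda>n. ?D n (A n)) \<longlonglongrightarrow> 0"
    using eq by (simp add: asymp_equivalent_def)
  then have "\<forall>\<^sub>F n in sequentially. \<bar>?D n (A n)\<bar> < e"
    using e by (auto simp: tendsto_iff dist_real_def)
  then show "\<forall>\<^sub>F n in sequentially. \<forall>A\<in>sets (S n). \<bar>?D n A\<bar> \<le> e"
  proof (rule eventually_mono, intro ballI)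
    fix n B assume "\<bar>?D n (A n)\<bar> < e" "B \<in> sets (S n)"
    then show "\<bar>?D n B\<bar> \<le> e"
      using A[of n] by (meson less_imp_le)
  qed
next
  assume bound: "\<forall>e>0. \<forall>\<^sub>F n in sequentially. \<forall>A\<in>sets (S n). \<bar>?D n A\<bar> \<le> e"
  show "asymp_equivalent S M X M' Y"
    unfolding asymp_equivalent_def
  proof (intro allI impI tendstoI)
    fix A and e :: real assume A: "\<forall>n\<ge>1. A n \<in> sets (S n)" and e: "0 < e"
    have "\<forall>\<^sub>F n in sequentially. \<forall>A\<in>sets (S n). \<bar>?D n A\<bar> \<le> e / 2"
      using bound half_gt_zero[OF e] by blast
    \<comment> \<open>The sets are known to be measurable for \<open>n \<ge> 1\<close> only.\<close>
    with eventually_ge_at_top[of 1] show "\<forall>\<^sub>F n in sequentially. dist (?D n (A n)) 0 < e"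
    proof eventually_elim
      case (elim n)
      then have "\<bar>?D n (A n)\<bar> \<le> e / 2" using A by blast
      then show ?case using e by (simp only: dist_real_def diff_0_right)
    qed
  qed
qed

text \<open>If some \<open>e\<close> admits no \<open>d\<close>, then for each \<open>k\<close>
  there are arbitrarily late \<open>n\<close> with a set of probability at most
  \<open>1 / (k + 1)\<close> for \<open>Y n\<close> and above \<open>e\<close> for
  \<open>X n\<close>. Placing such sets along a strictly increasing \<open>r\<close> violates
  contiguity.\<close>

lemma contiguous_iff:
  "contiguous S M X M' Y \<longleftrightarrow>
    (\<forall>e>0. \<exists>d>0. \<forall>\<^sub>F n in sequentially. \<forall>A\<in>sets (S n).
      \<P>(\<omega> in M' n. Y n \<omega> \<in> A) \<le> d \<longrightarrow> \<P>(\<omega> in M n. X n \<omega> \<in> A) \<le> e)"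
  (is "_ \<longleftrightarrow> (\<forall>e>0. \<exists>d>0. \<forall>\<^sub>F n in sequentially. \<forall>A\<in>sets (S n). ?Q n A \<le> d \<longrightarrow> ?P n A \<le> e)")
proof (intro iffI allI impI)
  fix e :: real assume contig: "contiguous S M X M' Y" and e: "0 < e"
  show "\<exists>d>0. \<forall>\<^sub>F n in sequentially. \<forall>A\<in>sets (S n). ?Q n A \<le> d \<longrightarrow> ?P n A \<le> e"
  proof (rule ccontr)
    assume neg: "\<not> ?thesis"
    define bad where "bad k n A \<longleftrightarrow> A \<in> sets (S n) \<and> ?Q n A \<le> 1 / real (Suc k) \<and> e < ?P n A" for k n A
    have freq: "\<exists>n>m. \<exists>A. bad k n A" for k m
    proof -
      have "0 < 1 / real (Suc k)" by simp
      with neg have "\<not> (\<forall>\<^sub>F n in sequentially. \<forall>A\<in>sets (S n). ?Q n A \<le> 1 / real (Suc k) \<longrightarrow> ?P n A \<le> e)"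
        by blast
      then have "\<exists>\<^sub>F n in sequentially. \<not> (\<forall>A\<in>sets (S n). ?Q n A \<le> 1 / real (Suc k) \<longrightarrow> ?P n A \<le> e)"
        unfolding not_eventually .
      then have "\<exists>\<^sub>F n in sequentially. \<exists>A. bad k n A"
        by (rule frequently_elim1) (unfold bad_def, meson not_le)
      then show ?thesis
        unfolding frequently_sequentially using Suc_le_lessD by blast
    qed
    have "\<exists>r. \<forall>k. (\<exists>A. bad k (r k) A) \<and> r k < r (Suc k)"
      by (rule dependent_nat_choice) (use freq in blast)+
    then obtain r B where B: "\<And>k. bad k (r k) (B k)" and "\<And>k. r k < r (Suc k)"
      by metis
    then have r: "strict_mono r"
      by (simp add: strict_mono_Suc_iff)
    \<comment> \<open>Off the range of \<open>r\<close> the empty set keeps the probabilities for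
      \<open>Y\<close> tending to 0.\<close>
    define A where "A n = (if n \<in> range r then B (inv r n) else {})" for n
    have A_r: "A (r k) = B k" for k
      using r by (simp add: A_def strict_mono_imp_inj_on inv_f_f)
    have A_sets: "A n \<in> sets (S n)" for n
    proof (cases "n \<in> range r")
      case True
      then show ?thesis using A_r B by (auto simp: bad_def)
    qed (simp add: A_def)
    have "(\<lambda>n. ?Q n (A n)) \<longlonglongrightarrow> 0"
    proof (rule tendstoI)
      fix x :: real assume "0 < x"
      then obtain k0 where k0: "1 / real (Suc k0) < x"
        using reals_Archimedean by (auto simp: inverse_eq_divide)
      have "?Q n (A n) < x" if n: "r k0 \<le> n" for n
      proof (cases "n \<in> range r")
        case True
        then obtain k where k: "n = r k" by auto
        then have "k0 \<le> k" using n r by (simp add: strict_mono_less_eq)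
        then have "1 / real (Suc k) \<le> 1 / real (Suc k0)"
          by (simp add: frac_le)
        moreover have "?Q n (A n) \<le> 1 / real (Suc k)"
          using B[of k] unfolding bad_def k A_r by blast
        ultimately show ?thesis using k0 by linarith
      qed (use \<open>0 < x\<close> in \<open>simp add: A_def\<close>)
      then show "\<forall>\<^sub>F n in sequentially. dist (?Q n (A n)) 0 < x"
        unfolding eventually_sequentially by (intro exI[of _ "r k0"]) auto
    qed
    then have "(\<lambda>n. ?P n (A n)) \<longlonglongrightarrow> 0"
      using contig A_sets by (simp add: contiguous_def)
    then have "\<forall>\<^sub>F n in sequentially. ?P n (A n) < e"
      using e by (rule order_tendstoD(2))
    then obtain m where "\<And>n. m \<le> n \<Longrightarrow> ?P n (A n) < e"
      by (auto simp: eventually_sequentially)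
    \<comment> \<open>A strictly increasing \<open>r\<close> satisfies
      \<open>m \<le> r m\<close>.\<close>
    then have "?P (r m) (A (r m)) < e"
      using seq_suble[OF r] by blast
    then show False
      using B[of m] unfolding bad_def A_r by simp
  qed
next
  assume bound: "\<forall>e>0. \<exists>d>0. \<forall>\<^sub>F n in sequentially. \<forall>A\<in>sets (S n). ?Q n A \<le> d \<longrightarrow> ?P n A \<le> e"
  show "contiguous S M X M' Y"
    unfolding contiguous_def
  proof (intro allI impI tendstoI)
    fix A and e :: real
    assume A: "\<forall>n\<ge>1. A n \<in> sets (S n)" and Q: "(\<lambda>n. ?Q n (A n)) \<longlonglongrightarrow> 0" and e: "0 < e"
    obtain d where "0 < d" and d: "\<forall>\<^sub>F n in sequentially. \<forall>A\<in>sets (S n). ?Q n A \<le> d \<longrightarrow> ?P n A \<le> e / 2"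
      using bound half_gt_zero[OF e] by blast
    from d order_tendstoD(2)[OF Q \<open>0 < d\<close>] eventually_ge_at_top[of 1]
    show "\<forall>\<^sub>F n in sequentially. dist (?P n (A n)) 0 < e"
    proof eventually_elim
      case (elim n)
      then have "?P n (A n) \<le> e / 2" using A less_imp_le by blast
      then have "?P n (A n) < e" using e by linarith
      then show ?case
        unfolding dist_real_def diff_0_right by (simp only: abs_of_nonneg measure_nonneg)
    qed
  qed
qed

section \<open>Criteria for sequences of product measures\<close>

text \<open>Bounds over all finite \<open>J\<close> stand for a bound on a possibly infinite sum.
  The threshold \<open>1 - exp (- e / 2)\<close> is the separation forced by a Hellinger sum
  \<open>e\<close>; conversely the bound \<open>2 * sqrt c\<close> equals \<open>e\<close> for
  \<open>c = (e / 2)\<^sup>2\<close>.\<close>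

lemma product_asymptotic_iff:
  fixes f g :: "nat \<Rightarrow> 'i \<Rightarrow> 'a::finite pmf" and I :: "nat \<Rightarrow> 'i set"
  defines "S \<equiv> \<lambda>n. sets (PiM (I n) (\<lambda>_. count_space UNIV))"
  shows "(\<forall>e>0. \<forall>\<^sub>F n in sequentially. \<forall>A\<in>S n.
      \<bar>measure (product (I n) (f n)) A - measure (product (I n) (g n)) A\<bar> \<le> e) \<longleftrightarrow>
    (\<forall>e>0. \<forall>\<^sub>F n in sequentially. \<forall>J. finite J \<and> J \<subseteq> I n \<longrightarrow>
      (\<Sum>i\<in>J. hellinger (f n i) (g n i)) \<le> e)"
    (is "?L \<longleftrightarrow> ?R")
proof (intro iffI allI impI)
  fix e :: real assume ?L and e: "0 < e"
  moreover have "0 < 1 - exp (- e / 2)"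
    using e by simp
  ultimately have "\<forall>\<^sub>F n in sequentially. \<forall>A\<in>S n.
      \<bar>measure (product (I n) (f n)) A - measure (product (I n) (g n)) A\<bar> \<le> 1 - exp (- e / 2)"
    by blast
  then show "\<forall>\<^sub>F n in sequentially. \<forall>J. finite J \<and> J \<subseteq> I n \<longrightarrow>
      (\<Sum>i\<in>J. hellinger (f n i) (g n i)) \<le> e"
  proof (eventually_elim, intro allI impI)
    fix n J assume le: "\<forall>A\<in>S n.
        \<bar>measure (product (I n) (f n)) A - measure (product (I n) (g n)) A\<bar> \<le> 1 - exp (- e / 2)"
      and J: "finite J \<and> J \<subseteq> I n"
    obtain A where "A \<in> S n" "1 - exp (- (\<Sum>i\<in>J. hellinger (f n i) (g n i)) / 2) \<le>
        measure (product (I n) (f n)) A - measure (product (I n) (g n)) A"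
      using ex_separating_set[of J "I n" "f n" "g n"] J by (auto simp: S_def)
    then have "exp (- e / 2) \<le> exp (- (\<Sum>i\<in>J. hellinger (f n i) (g n i)) / 2)"
      using le by (smt (verit) abs_ge_self)
    then show "(\<Sum>i\<in>J. hellinger (f n i) (g n i)) \<le> e"
      by simp
  qed
next
  fix e :: real assume ?R and e: "0 < e"
  then have "\<forall>\<^sub>F n in sequentially. \<forall>J. finite J \<and> J \<subseteq> I n \<longrightarrow>
      (\<Sum>i\<in>J. hellinger (f n i) (g n i)) \<le> (e / 2)\<^sup>2"
    by simp
  then show "\<forall>\<^sub>F n in sequentially. \<forall>A\<in>S n.
      \<bar>measure (product (I n) (f n)) A - measure (product (I n) (g n)) A\<bar> \<le> e"
  proof (eventually_elim, intro ballI)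
    fix n A assume "\<forall>J. finite J \<and> J \<subseteq> I n \<longrightarrow> (\<Sum>i\<in>J. hellinger (f n i) (g n i)) \<le> (e / 2)\<^sup>2"
      and "A \<in> S n"
    then show "\<bar>measure (product (I n) (f n)) A - measure (product (I n) (g n)) A\<bar> \<le> e"
      using product_measure_diff_le[of A "I n" "f n" "g n" "(e / 2)\<^sup>2"] e by (simp add: S_def)
  qed
qed

text \<open>For \<open>C \<ge> 4\<close> a heavy value has
  \<open>sqrt (pmf g v) \<le> sqrt (pmf f v) / 2\<close>, so the difference of the roots is at least
  half of \<open>sqrt (pmf f v)\<close>.\<close>

lemma sum_heavy_le_hellinger:
  fixes f g :: "'a::finite pmf"
  assumes C: "4 \<le> C"
  shows "(\<Sum>v\<in>heavy C f g. pmf f v) \<le> 4 * hellinger f g"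
proof -
  have "pmf f v \<le> 4 * (sqrt (pmf f v) - sqrt (pmf g v))\<^sup>2" if "v \<in> heavy C f g" for v
  proof -
    have "4 * pmf g v \<le> pmf f v"
      using that mult_right_mono[OF C, of "pmf g v"] by (simp add: heavy_def)
    then have "2 * sqrt (pmf g v) \<le> sqrt (pmf f v)"
      using real_sqrt_le_mono[of "4 * pmf g v" "pmf f v"] by (simp add: real_sqrt_mult)
    then have "(sqrt (pmf f v) / 2)\<^sup>2 \<le> (sqrt (pmf f v) - sqrt (pmf g v))\<^sup>2"
      by (intro power_mono) auto
    then show ?thesis by (simp add: power_divide)
  qed
  then have "(\<Sum>v\<in>heavy C f g. pmf f v) \<le> (\<Sum>v\<in>heavy C f g. 4 * (sqrt (pmf f v) - sqrt (pmf g v))\<^sup>2)"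
    by (rule sum_mono)
  also have "\<dots> \<le> (\<Sum>v\<in>UNIV. 4 * (sqrt (pmf f v) - sqrt (pmf g v))\<^sup>2)"
    by (intro sum_mono2) auto
  finally show ?thesis
    by (simp add: hellinger_def sum_distrib_left)
qed

text \<open>The tail condition \<open>?R2\<close> is derived with the help of \<open>?R1\<close>:
  the Hellinger bound limits the heavy mass under \<open>f\<close>, hence that under
  \<open>g\<close>, and contiguity is applied to the hitting sets. The converse rests on
  \<open>product_measure_le\<close>.\<close>

lemma product_contiguous_iff:
  fixes f g :: "nat \<Rightarrow> 'i \<Rightarrow> 'a::finite pmf" and I :: "nat \<Rightarrow> 'i set"
  defines "S \<equiv> \<lambda>n. sets (PiM (I n) (\<lambda>_. count_space UNIV))"
  shows "(\<forall>e>0. \<exists>d>0. \<forall>\<^sub>F n in sequentially. \<forall>A\<in>S n.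
      measure (product (I n) (g n)) A \<le> d \<longrightarrow> measure (product (I n) (f n)) A \<le> e) \<longleftrightarrow>
    (\<exists>s\<ge>0. \<forall>\<^sub>F n in sequentially. \<forall>J. finite J \<and> J \<subseteq> I n \<longrightarrow>
      (\<Sum>i\<in>J. hellinger (f n i) (g n i)) \<le> s) \<and>
    (\<forall>e>0. \<exists>C0. \<forall>C\<ge>C0. \<forall>\<^sub>F n in sequentially. \<forall>J. finite J \<and> J \<subseteq> I n \<longrightarrow>
      (\<Sum>i\<in>J. \<Sum>v\<in>heavy C (f n i) (g n i). pmf (f n i) v) \<le> e)"
    (is "?L \<longleftrightarrow> ?R1 \<and> ?R2")
proof (intro iffI conjI)
  assume ?L
  then obtain d where "0 < d" and d: "\<forall>\<^sub>F n in sequentially. \<forall>A\<in>S n.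
      measure (product (I n) (g n)) A \<le> d \<longrightarrow> measure (product (I n) (f n)) A \<le> 1 / 2"
    using half_gt_zero[of 1] by (auto dest!: spec[of _ "1 / 2 :: real"])
  \<comment> \<open>A Hellinger sum above \<open>s\<close> would give a set of measure at most
    \<open>d\<close> under \<open>g\<close> and at least \<open>3 / 4\<close> under
    \<open>f\<close>, against the bound \<open>1 / 2\<close>. The minimum with \<open>1 / 4\<close>
    also makes \<open>s\<close> nonnegative.\<close>
  define s where "s = - 2 * ln (min d (1 / 4))"
  have s: "exp (- s / 2) = min d (1 / 4)"
    using \<open>0 < d\<close> by (simp add: s_def)
  from d have "\<forall>\<^sub>F n in sequentially. \<forall>J. finite J \<and> J \<subseteq> I n \<longrightarrow>
      (\<Sum>i\<in>J. hellinger (f n i) (g n i)) \<le> s"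
  proof (eventually_elim, intro allI impI)
    fix n J assume le: "\<forall>A\<in>S n.
        measure (product (I n) (g n)) A \<le> d \<longrightarrow> measure (product (I n) (f n)) A \<le> 1 / 2"
      and J: "finite J \<and> J \<subseteq> I n"
    show "(\<Sum>i\<in>J. hellinger (f n i) (g n i)) \<le> s"
    proof (rule ccontr)
      assume "\<not> (\<Sum>i\<in>J. hellinger (f n i) (g n i)) \<le> s"
      then have "exp (- (\<Sum>i\<in>J. hellinger (f n i) (g n i)) / 2) < exp (- s / 2)"
        by simp
      then have h: "exp (- (\<Sum>i\<in>J. hellinger (f n i) (g n i)) / 2) < min d (1 / 4)"
        unfolding s .
      obtain A where A: "A \<in> S n" "1 - exp (- (\<Sum>i\<in>J. hellinger (f n i) (g n i)) / 2) \<le>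
          measure (product (I n) (f n)) A - measure (product (I n) (g n)) A"
        using ex_separating_set[of J "I n" "f n" "g n"] J by (auto simp: S_def)
      have "measure (product (I n) (f n)) A \<le> 1" "0 \<le> measure (product (I n) (g n)) A"
        using prob_space.prob_le_1[OF prob_space_product] by auto
      then have "measure (product (I n) (g n)) A \<le> d" "3 / 4 \<le> measure (product (I n) (f n)) A"
        using A(2) h by linarith+
      then show False using le A(1) by force
    qed
  qed
  moreover have "0 \<le> s"
    using exp_le_cancel_iff[of "- s / 2" 0] unfolding s by (simp add: min_le_iff_disj)
  ultimately show ?R1 by blast
  then obtain s where s: "\<forall>\<^sub>F n in sequentially. \<forall>J. finite J \<and> J \<subseteq> I n \<longrightarrow>
      (\<Sum>i\<in>J. hellinger (f n i) (g n i)) \<le> s" by blast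
  show ?R2
  proof (intro allI impI)
    fix e :: real assume e: "0 < e"
    then have "0 < 1 - exp (- e)" by simp
    with \<open>?L\<close> obtain d where "0 < d" and d: "\<forall>\<^sub>F n in sequentially. \<forall>A\<in>S n.
        measure (product (I n) (g n)) A \<le> d \<longrightarrow> measure (product (I n) (f n)) A \<le> 1 - exp (- e)"
      by blast
    \<comment> \<open>The bound 4 is what \<open>sum_heavy_le_hellinger\<close> asks for;
      \<open>4 * s / d\<close> brings the heavy mass under \<open>g\<close>, which is at most
      \<open>4 * s / C\<close>, down to \<open>d\<close>.\<close>
    have "\<forall>\<^sub>F n in sequentially. \<forall>J. finite J \<and> J \<subseteq> I n \<longrightarrow>
      (\<Sum>i\<in>J. \<Sum>v\<in>heavy C (f n i) (g n i). pmf (f n i) v) \<le> e" if C: "max 4 (4 * s / d) \<le> C" for C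
      using s d
    proof (eventually_elim, intro allI impI)
      fix n J assume s: "\<forall>J. finite J \<and> J \<subseteq> I n \<longrightarrow> (\<Sum>i\<in>J. hellinger (f n i) (g n i)) \<le> s"
        and d: "\<forall>A\<in>S n. measure (product (I n) (g n)) A \<le> d \<longrightarrow>
          measure (product (I n) (f n)) A \<le> 1 - exp (- e)"
        and J: "finite J \<and> J \<subseteq> I n"
      let ?H = "\<lambda>i. heavy C (f n i) (g n i)"
      have C': "4 \<le> C" "4 * s \<le> C * d"
        using C \<open>0 < d\<close> by (auto simp: divide_le_eq)
      obtain A where A: "A \<in> S n"
          "1 - exp (- (\<Sum>i\<in>J. \<Sum>v\<in>?H i. pmf (f n i) v)) \<le> measure (product (I n) (f n)) A"
          "measure (product (I n) (g n)) A \<le> (\<Sum>i\<in>J. \<Sum>v\<in>?H i. pmf (g n i) v)"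
        using ex_hitting_set[of J "I n" "f n" ?H "g n"] J by (auto simp: S_def)
      have "C * (\<Sum>i\<in>J. \<Sum>v\<in>?H i. pmf (g n i) v) \<le> (\<Sum>i\<in>J. \<Sum>v\<in>?H i. pmf (f n i) v)"
        unfolding sum_distrib_left by (intro sum_mono) (auto simp: heavy_def)
      also have "\<dots> \<le> (\<Sum>i\<in>J. 4 * hellinger (f n i) (g n i))"
        by (intro sum_mono sum_heavy_le_hellinger C')
      also have "\<dots> \<le> 4 * s"
        using s J by (simp add: sum_distrib_left[symmetric])
      also note C'(2)
      finally have "(\<Sum>i\<in>J. \<Sum>v\<in>?H i. pmf (g n i) v) \<le> d"
        using C'(1) by simp
      then have "measure (product (I n) (f n)) A \<le> 1 - exp (- e)"
        using d A(1,3) by force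
      then have "exp (- e) \<le> exp (- (\<Sum>i\<in>J. \<Sum>v\<in>?H i. pmf (f n i) v))"
        using A(2) by linarith
      then show "(\<Sum>i\<in>J. \<Sum>v\<in>?H i. pmf (f n i) v) \<le> e"
        by simp
    qed
    then show "\<exists>C0. \<forall>C\<ge>C0. \<forall>\<^sub>F n in sequentially. \<forall>J. finite J \<and> J \<subseteq> I n \<longrightarrow>
      (\<Sum>i\<in>J. \<Sum>v\<in>heavy C (f n i) (g n i). pmf (f n i) v) \<le> e"
      by blast
  qed
next
  assume "?R1 \<and> ?R2"
  show ?L
  proof (intro allI impI)
    fix e :: real assume e: "0 < e"
    obtain s where s: "\<forall>\<^sub>F n in sequentially. \<forall>J. finite J \<and> J \<subseteq> I n \<longrightarrow>
        (\<Sum>i\<in>J. hellinger (f n i) (g n i)) \<le> s"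
      using \<open>?R1 \<and> ?R2\<close> by blast
    obtain C0 where C0: "\<And>C. C0 \<le> C \<Longrightarrow> \<forall>\<^sub>F n in sequentially. \<forall>J. finite J \<and> J \<subseteq> I n \<longrightarrow>
        (\<Sum>i\<in>J. \<Sum>v\<in>heavy C (f n i) (g n i). pmf (f n i) v) \<le> e / 2"
      using \<open>?R1 \<and> ?R2\<close> half_gt_zero[OF e] by blast
    define C where "C = max 1 C0"
    define K where "K = exp ((1 + sqrt C)\<^sup>2 * s)"
    have K: "0 < K" by (simp add: K_def)
    \<comment> \<open>Chosen so that \<open>sqrt (K * d) = e / 2\<close>; the other half of
      \<open>e\<close> is for the heavy mass.\<close>
    define d where "d = (e / 2)\<^sup>2 / K"
    have "0 < d" using e K by (simp add: d_def)
    moreover have "\<forall>\<^sub>F n in sequentially. \<forall>A\<in>S n.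
      measure (product (I n) (g n)) A \<le> d \<longrightarrow> measure (product (I n) (f n)) A \<le> e"
      using s C0[of C, unfolded C_def, OF max.cobounded2, folded C_def]
    proof (eventually_elim, intro ballI impI)
      fix n A assume s: "\<forall>J. finite J \<and> J \<subseteq> I n \<longrightarrow> (\<Sum>i\<in>J. hellinger (f n i) (g n i)) \<le> s"
        and c: "\<forall>J. finite J \<and> J \<subseteq> I n \<longrightarrow>
          (\<Sum>i\<in>J. \<Sum>v\<in>heavy C (f n i) (g n i). pmf (f n i) v) \<le> e / 2"
        and A: "A \<in> S n" "measure (product (I n) (g n)) A \<le> d"
      have "sqrt (K * measure (product (I n) (g n)) A) \<le> sqrt (K * d)"
        using A(2) K by simp
      also have "\<dots> = e / 2"
        using K e by (simp add: d_def)
      finally show "measure (product (I n) (f n)) A \<le> e"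
        using product_measure_le[of A "I n" C "f n" "g n" s "e / 2"] s c A(1)
        by (simp add: S_def K_def C_def)
    qed
    ultimately show "\<exists>d>0. \<forall>\<^sub>F n in sequentially. \<forall>A\<in>S n.
        measure (product (I n) (g n)) A \<le> d \<longrightarrow> measure (product (I n) (f n)) A \<le> e"
      by blast
  qed
qed

section \<open>From random vectors to products of Bernoulli laws\<close>

text \<open>Independence of a nonempty family says that its joint law is the product of the marginal
  laws.\<close>

lemma prob_indep_vars_vector:
  assumes "prob_space M" and I: "I \<noteq> {}"
    and indep: "prob_space.indep_vars M (\<lambda>_. count_space UNIV) Z I"
    and Z: "\<And>i. i \<in> I \<Longrightarrow> distr M (count_space UNIV) (Z i) = measure_pmf (f i)"
    and A: "A \<in> sets (PiM I (\<lambda>_. count_space UNIV))"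
  shows "\<P>(\<omega> in M. (\<lambda>i\<in>I. Z i \<omega>) \<in> A) = measure (product I f) A"
proof -
  interpret prob_space M by fact
  have rv: "\<And>i. i \<in> I \<Longrightarrow> random_variable (count_space UNIV) (Z i)"
    using indep by (simp add: indep_vars_def)
  have "distr M (PiM I (\<lambda>_. count_space UNIV)) (\<lambda>\<omega>. \<lambda>i\<in>I. Z i \<omega>) =
      PiM I (\<lambda>i. distr M (count_space UNIV) (Z i))"
    using indep_vars_iff_distr_eq_PiM'[OF I rv] indep by simp
  also have "\<dots> = product I f"
    by (intro PiM_cong Z refl)
  finally have "measure (product I f) A =
      measure (distr M (PiM I (\<lambda>_. count_space UNIV)) (\<lambda>\<omega>. \<lambda>i\<in>I. Z i \<omega>)) A"
    by simp
  also have "\<dots> = prob ((\<lambda>\<omega>. \<lambda>i\<in>I. Z i \<omega>) -` A \<inter> space M)"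
    by (intro measure_distr measurable_restrict rv A)
  finally show ?thesis
    by (simp add: vimage_def Int_def conj_commute)
qed

lemma hellinger_bernoulli:
  "p \<in> {0..1} \<Longrightarrow> p' \<in> {0..1} \<Longrightarrow> hellinger (bernoulli_pmf p) (bernoulli_pmf p') = rho p p'"
  by (simp add: hellinger_def rho_def UNIV_bool)

text \<open>\<open>True\<close> contributes the first summand and \<open>False\<close> the second;
  the sum over heavy values thus merges the two sums of the tail condition.\<close>

lemma sum_heavy_bernoulli:
  assumes "p \<in> {0..1}" "p' \<in> {0..1}"
  shows "(\<Sum>v\<in>heavy C (bernoulli_pmf p) (bernoulli_pmf p'). pmf (bernoulli_pmf p) v) =
    (if C * p' < p then p else 0) + (if C * (1 - p') < 1 - p then 1 - p else 0)"
proof -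
  have "(\<Sum>v\<in>heavy C (bernoulli_pmf p) (bernoulli_pmf p'). pmf (bernoulli_pmf p) v) =
      (\<Sum>v\<in>UNIV. if v \<in> heavy C (bernoulli_pmf p) (bernoulli_pmf p') then pmf (bernoulli_pmf p) v else 0)"
    by (simp add: sum.If_cases)
  then show ?thesis
    using assms by (simp add: UNIV_bool heavy_def)
qed

section \<open>Sums and limits in [0,\<infinity>]\<close>

text \<open>In \<open>ennreal\<close> an infinite sum is the supremum of its finite partial sums.
  The bound \<open>c\<close> is taken nonnegative because \<open>ennreal\<close> sends negative
  reals to 0.\<close>

lemma infsum_ennreal_le_iff:
  assumes "\<And>i. i \<in> I \<Longrightarrow> 0 \<le> f i" and "0 \<le> c"
  shows "(\<Sum>\<^sub>\<infinity>i\<in>I. ennreal (f i)) \<le> ennreal c \<longleftrightarrow> (\<forall>J. finite J \<and> J \<subseteq> I \<longrightarrow> sum f J \<le> c)"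
proof -
  have "sum (\<lambda>i. ennreal (f i)) J \<le> ennreal c \<longleftrightarrow> sum f J \<le> c" if "J \<subseteq> I" for J
    using that assms by (subst sum_ennreal) (auto simp: ennreal_le_iff)
  then show ?thesis
    by (subst nonneg_infsum_complete) (auto simp: SUP_le_iff)
qed

lemma ennreal_tendsto_0_iff_eventually_le:
  fixes u :: "'b \<Rightarrow> ennreal"
  shows "(u \<longlongrightarrow> 0) F \<longleftrightarrow> (\<forall>e>0. \<forall>\<^sub>F x in F. u x \<le> ennreal e)"
proof (intro iffI allI impI)
  fix e :: real assume "(u \<longlongrightarrow> 0) F" "0 < e"
  then have "\<forall>\<^sub>F x in F. u x < ennreal e"
    by (intro order_tendstoD(2)) auto
  then show "\<forall>\<^sub>F x in F. u x \<le> ennreal e"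
    by eventually_elim simp
next
  assume le: "\<forall>e>0. \<forall>\<^sub>F x in F. u x \<le> ennreal e"
  show "(u \<longlongrightarrow> 0) F"
  proof (rule order_tendstoI)
    fix a :: ennreal assume "0 < a"
    then obtain b where b: "0 < b" "b < a" using dense by blast
    then obtain r where r: "b = ennreal r" "0 \<le> r"
      by (cases b) auto
    then have "\<forall>\<^sub>F x in F. u x \<le> b" using le b by (auto simp: ennreal_less_zero_iff)
    then show "\<forall>\<^sub>F x in F. u x < a"
      by eventually_elim (use b in simp)
  qed simp
qed

text \<open>Halving \<open>e\<close> leaves room to pass from a bound on the limsup to a strict
  bound that holds eventually.\<close>

lemma limsup_tendsto_0_iff:
  fixes D :: "'b \<Rightarrow> nat \<Rightarrow> ennreal"
  shows "((\<lambda>C. limsup (D C)) \<longlongrightarrow> 0) F \<longleftrightarrow>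
    (\<forall>e>0. \<forall>\<^sub>F C in F. \<forall>\<^sub>F n in sequentially. D C n \<le> ennreal e)"
  unfolding ennreal_tendsto_0_iff_eventually_le
proof (intro iffI allI impI)
  fix e :: real assume lim: "\<forall>e>0. \<forall>\<^sub>F C in F. limsup (D C) \<le> ennreal e" and e: "0 < e"
  from lim e have "\<forall>\<^sub>F C in F. limsup (D C) \<le> ennreal (e / 2)"
    by simp
  then show "\<forall>\<^sub>F C in F. \<forall>\<^sub>F n in sequentially. D C n \<le> ennreal e"
  proof eventually_elim
    case (elim C)
    also have "ennreal (e / 2) < ennreal e"
      using e by (simp add: ennreal_lessI)
    finally have "\<forall>\<^sub>F n in sequentially. D C n < ennreal e"
      by (rule Limsup_lessD)
    then show ?case by eventually_elim simp
  qed
next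
  fix e :: real assume "\<forall>e>0. \<forall>\<^sub>F C in F. \<forall>\<^sub>F n in sequentially. D C n \<le> ennreal e" and "0 < e"
  then have "\<forall>\<^sub>F C in F. \<forall>\<^sub>F n in sequentially. D C n \<le> ennreal e"
    by blast
  then show "\<forall>\<^sub>F C in F. limsup (D C) \<le> ennreal e"
    by eventually_elim (rule Limsup_bounded)
qed

text \<open>A negative bound may be replaced by 0, which \<open>ennreal\<close> does anyway.\<close>

lemma bounded_at_top_iff:
  "bounded_at_top a \<longleftrightarrow> (\<exists>s\<ge>0. \<forall>\<^sub>F n in sequentially. a n \<le> ennreal s)"
proof
  assume "bounded_at_top a"
  then obtain s where s: "\<forall>\<^sub>F n in sequentially. a n \<le> ennreal s"
    unfolding bounded_at_top_def by blast
  have "ennreal s \<le> ennreal (max 0 s)"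
    by (intro ennreal_leI) simp
  with s have "\<forall>\<^sub>F n in sequentially. a n \<le> ennreal (max 0 s)"
    using order_trans by (blast intro: eventually_mono)
  then show "\<exists>s\<ge>0. \<forall>\<^sub>F n in sequentially. a n \<le> ennreal s"
    by (intro exI[of _ "max 0 s"]) simp
qed (auto simp: bounded_at_top_def)

text \<open>Extending both sums by 0 to all of \<open>I\<close> lets them be added term by
  term.\<close>

lemma infsum_heavy_bernoulli:
  assumes p: "\<And>i. i \<in> I \<Longrightarrow> p i \<in> {0..1}" and p': "\<And>i. i \<in> I \<Longrightarrow> p' i \<in> {0..1}"
  shows "(\<Sum>\<^sub>\<infinity>i\<in>{i \<in> I. p i > C * p' i}. ennreal (p i))
      + (\<Sum>\<^sub>\<infinity>i\<in>{i \<in> I. 1 - p i > C * (1 - p' i)}. ennreal (1 - p i)) =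
    (\<Sum>\<^sub>\<infinity>i\<in>I. ennreal (\<Sum>v\<in>heavy C (bernoulli_pmf (p i)) (bernoulli_pmf (p' i)).
      pmf (bernoulli_pmf (p i)) v))"
proof -
  have restrict: "(\<Sum>\<^sub>\<infinity>i\<in>{i \<in> I. R i}. ennreal (w i)) = (\<Sum>\<^sub>\<infinity>i\<in>I. ennreal (if R i then w i else 0))" for R w
    by (rule infsum_cong_neutral) auto
  show ?thesis
    unfolding restrict
    by (subst infsum_add[symmetric])
      (use p p' in \<open>auto intro!: nonneg_summable_on_complete infsum_cong simp: sum_heavy_bernoulli ennreal_plus\<close>)
qed

theorem theorem2p2:
  fixes N :: "nat \<Rightarrow> enat"
    and M :: "nat \<Rightarrow> 'a measure" and M' :: "nat \<Rightarrow> 'b measure"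
    and I :: "nat \<Rightarrow> nat \<Rightarrow> 'a \<Rightarrow> bool" and I' :: "nat \<Rightarrow> nat \<Rightarrow> 'b \<Rightarrow> bool"
    and X :: "nat \<Rightarrow> 'a \<Rightarrow> nat \<Rightarrow> bool" and X' :: "nat \<Rightarrow> 'b \<Rightarrow> nat \<Rightarrow> bool"
    and p p' q q' :: "nat \<Rightarrow> nat \<Rightarrow> real"
  assumes N: "\<And>n. n \<ge> 1 \<Longrightarrow> N n \<ge> 1"
    and prob: "\<And>n. n \<ge> 1 \<Longrightarrow> prob_space (M n)"
    and prob': "\<And>n. n \<ge> 1 \<Longrightarrow> prob_space (M' n)"
    and p: "\<And>n i. n \<ge> 1 \<Longrightarrow> i \<in> index_set (N n) \<Longrightarrow> p n i \<in> {0..1}"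
    and p': "\<And>n i. n \<ge> 1 \<Longrightarrow> i \<in> index_set (N n) \<Longrightarrow> p' n i \<in> {0..1}"
    and q: "\<And>n i. q n i = 1 - p n i"
    and q': "\<And>n i. q' n i = 1 - p' n i"
    and indep: "\<And>n. n \<ge> 1 \<Longrightarrow>
      prob_space.indep_vars (M n) (\<lambda>_. count_space UNIV) (I n) (index_set (N n))"
    and indep': "\<And>n. n \<ge> 1 \<Longrightarrow>
      prob_space.indep_vars (M' n) (\<lambda>_. count_space UNIV) (I' n) (index_set (N n))"
    and Be: "\<And>n i. n \<ge> 1 \<Longrightarrow> i \<in> index_set (N n) \<Longrightarrow>
      distr (M n) (count_space UNIV) (I n i) = measure_pmf (bernoulli_pmf (p n i))"
    and Be': "\<And>n i. n \<ge> 1 \<Longrightarrow> i \<in> index_set (N n) \<Longrightarrow>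
      distr (M' n) (count_space UNIV) (I' n i) = measure_pmf (bernoulli_pmf (p' n i))"
    and X: "\<And>n \<omega>. X n \<omega> = (\<lambda>i\<in>index_set (N n). I n i \<omega>)"
    and X': "\<And>n \<omega>. X' n \<omega> = (\<lambda>i\<in>index_set (N n). I' n i \<omega>)"
  shows
    "(asymp_equivalent (\<lambda>n. cube (N n)) M X M' X' \<longleftrightarrow>
        (\<lambda>n. \<Sum>\<^sub>\<infinity>i\<in>index_set (N n). ennreal (rho (p n i) (p' n i))) \<longlonglongrightarrow> 0)
     \<and>
     (contiguous (\<lambda>n. cube (N n)) M X M' X' \<longleftrightarrow>
        bounded_at_top (\<lambda>n. \<Sum>\<^sub>\<infinity>i\<in>index_set (N n). ennreal (rho (p n i) (p' n i)))
        \<and> ((\<lambda>C::real. limsup (\<lambda>n.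
              (\<Sum>\<^sub>\<infinity>i\<in>{i \<in> index_set (N n). p n i > C * p' n i}. ennreal (p n i))
            + (\<Sum>\<^sub>\<infinity>i\<in>{i \<in> index_set (N n). q n i > C * q' n i}. ennreal (q n i))))
           \<longlongrightarrow> 0) at_top)"
proof -
  let ?I = "\<lambda>n. index_set (N n)"
  let ?f = "\<lambda>n i. bernoulli_pmf (p n i)" and ?g = "\<lambda>n i. bernoulli_pmf (p' n i)"
  let ?S = "\<lambda>n. sets (PiM (?I n) (\<lambda>_. count_space UNIV))"
  let ?P = "\<lambda>n. measure (product (?I n) (?f n))" and ?Q = "\<lambda>n. measure (product (?I n) (?g n))"
  \<comment> \<open>Coordinate 1 is always present, so the vectors are nonempty families.\<close>
  have ne: "?I n \<noteq> {}" if "n \<ge> 1" for n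
    using N[OF that] by (auto simp: index_set_def one_enat_def intro!: exI[of _ 1])
  have P: "\<P>(\<omega> in M n. X n \<omega> \<in> A) = ?P n A" and Q: "\<P>(\<omega> in M' n. X' n \<omega> \<in> A) = ?Q n A"
    if "n \<ge> 1" "A \<in> ?S n" for n A
    unfolding X X'
    using prob_indep_vars_vector[OF prob ne indep Be] prob_indep_vars_vector[OF prob' ne indep' Be'] that
    by simp_all
  \<comment> \<open>The assumptions on the vectors cover \<open>n \<ge> 1\<close>, and eventual
    statements do not see the index 0.\<close>
  have ev: "(\<forall>\<^sub>F n in sequentially. \<Phi> n) \<longleftrightarrow> (\<forall>\<^sub>F n in sequentially. \<Psi> n)"
    if "\<And>n. n \<ge> 1 \<Longrightarrow> \<Phi> n \<longleftrightarrow> \<Psi> n" for \<Phi> \<Psi>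
    by (rule eventually_cong[OF eventually_ge_at_top[of 1] that])
  have rho: "(\<Sum>\<^sub>\<infinity>i\<in>?I n. ennreal (rho (p n i) (p' n i))) \<le> ennreal c \<longleftrightarrow>
      (\<forall>J. finite J \<and> J \<subseteq> ?I n \<longrightarrow> (\<Sum>i\<in>J. hellinger (?f n i) (?g n i)) \<le> c)"
    if n: "n \<ge> 1" and c: "0 \<le> c" for n c
  proof -
    have "(\<Sum>\<^sub>\<infinity>i\<in>?I n. ennreal (rho (p n i) (p' n i))) =
        (\<Sum>\<^sub>\<infinity>i\<in>?I n. ennreal (hellinger (?f n i) (?g n i)))"
      by (intro infsum_cong) (use p p' n in \<open>simp add: hellinger_bernoulli\<close>)
    then show ?thesis
      by (simp add: infsum_ennreal_le_iff hellinger_nonneg c)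
  qed
  have heavy: "(\<Sum>\<^sub>\<infinity>i\<in>{i \<in> ?I n. p n i > C * p' n i}. ennreal (p n i))
        + (\<Sum>\<^sub>\<infinity>i\<in>{i \<in> ?I n. q n i > C * q' n i}. ennreal (q n i)) \<le> ennreal c \<longleftrightarrow>
      (\<forall>J. finite J \<and> J \<subseteq> ?I n \<longrightarrow>
        (\<Sum>i\<in>J. \<Sum>v\<in>heavy C (?f n i) (?g n i). pmf (?f n i) v) \<le> c)"
    if n: "n \<ge> 1" and c: "0 \<le> c" for n c C
  proof -
    have "(\<Sum>\<^sub>\<infinity>i\<in>{i \<in> ?I n. p n i > C * p' n i}. ennreal (p n i))
        + (\<Sum>\<^sub>\<infinity>i\<in>{i \<in> ?I n. q n i > C * q' n i}. ennreal (q n i)) =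
      (\<Sum>\<^sub>\<infinity>i\<in>?I n. ennreal (\<Sum>v\<in>heavy C (?f n i) (?g n i). pmf (?f n i) v))"
      unfolding q q' by (rule infsum_heavy_bernoulli) (use p p' n in blast)+
    then show ?thesis
      by (simp only:) (intro infsum_ennreal_le_iff sum_nonneg pmf_nonneg c)
  qed
  have "asymp_equivalent (\<lambda>n. cube (N n)) M X M' X' \<longleftrightarrow>
      (\<forall>e>0. \<forall>\<^sub>F n in sequentially. \<forall>A\<in>?S n. \<bar>?P n A - ?Q n A\<bar> \<le> e)"
    unfolding asymp_equivalent_iff cube_def by (intro all_cong ev) (simp add: P Q)
  also have "\<dots> \<longleftrightarrow> (\<lambda>n. \<Sum>\<^sub>\<infinity>i\<in>?I n. ennreal (rho (p n i) (p' n i))) \<longlonglongrightarrow> 0"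
    unfolding product_asymptotic_iff ennreal_tendsto_0_iff_eventually_le
    by (intro all_cong ev) (simp add: rho)
  finally have i: "asymp_equivalent (\<lambda>n. cube (N n)) M X M' X' \<longleftrightarrow>
    (\<lambda>n. \<Sum>\<^sub>\<infinity>i\<in>?I n. ennreal (rho (p n i) (p' n i))) \<longlonglongrightarrow> 0" .
  have "contiguous (\<lambda>n. cube (N n)) M X M' X' \<longleftrightarrow>
      (\<forall>e>0. \<exists>d>0. \<forall>\<^sub>F n in sequentially. \<forall>A\<in>?S n. ?Q n A \<le> d \<longrightarrow> ?P n A \<le> e)"
    unfolding contiguous_iff cube_def
    by (intro all_cong ex_cong1 conj_cong refl ev) (simp add: P Q)
  note ii = this[unfolded product_contiguous_iff]
  have hell: "(\<exists>s\<ge>0. \<forall>\<^sub>F n in sequentially. \<forall>J. finite J \<and> J \<subseteq> ?I n \<longrightarrow>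
        (\<Sum>i\<in>J. hellinger (?f n i) (?g n i)) \<le> s) \<longleftrightarrow>
      bounded_at_top (\<lambda>n. \<Sum>\<^sub>\<infinity>i\<in>?I n. ennreal (rho (p n i) (p' n i)))"
    unfolding bounded_at_top_iff by (intro ex_cong1 conj_cong refl ev) (simp only: rho)
  have tail: "(\<forall>e>0. \<exists>C0. \<forall>C\<ge>C0. \<forall>\<^sub>F n in sequentially. \<forall>J. finite J \<and> J \<subseteq> ?I n \<longrightarrow>
        (\<Sum>i\<in>J. \<Sum>v\<in>heavy C (?f n i) (?g n i). pmf (?f n i) v) \<le> e) \<longleftrightarrow>
      ((\<lambda>C::real. limsup (\<lambda>n.
          (\<Sum>\<^sub>\<infinity>i\<in>{i \<in> index_set (N n). p n i > C * p' n i}. ennreal (p n i))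
        + (\<Sum>\<^sub>\<infinity>i\<in>{i \<in> index_set (N n). q n i > C * q' n i}. ennreal (q n i))))
       \<longlongrightarrow> 0) at_top"
    \<comment> \<open>The limit in \<open>C\<close> unfolds to a threshold \<open>C0\<close> beyond
      which the bound holds eventually in \<open>n\<close>, which is the form of the
      criterion.\<close>
    unfolding limsup_tendsto_0_iff eventually_at_top_linorder[where 'a = real]
    by (intro all_cong ex_cong1 ev) (simp only: heavy less_imp_le)
  show ?thesis
    using i ii unfolding hell tail by (rule conjI)
qed

end
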